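(* Let $(C,(O_j)_{j\in[1..n]},L,Q)$ be the tuple defined in the context for a Multiple Idempotent Work Stealing Deque, with trace language $$L=\{v\in\mathbb{M}(\Sigma)\mid\forall i\in[1..n],\ \forall t\in\mathbb{T}:\ |v|_{\mathsf{pushBottom}_{i,t}}\le 1\ \wedge\ \mathsf{d\_state}(i,v)\ne\bot\},$$ where $|v|_x$ is the number of occurrences of the letter $x$ in $v$. Then $(C,(O_j)_j,L,Q)$ specifies a Process-Commutative Object; that is, $L$ satisfies Initial emptiness, $C^*$-closure and $I$-diamond closure.
   Context: **Process-Commutative Object specification.** Given pairwise disjoint sets of updates $C$ (common updates) and $O_1,\dots,O_n$ ($O_i$ exclusive to process $p_i$), let $\Sigma=C\cup\bigcup_i O_i$, $I=\Sigma\times\Sigma\setminus\bigcup_i(O_i\times O_i)$, let $\sim_I$ be the least congruence on $\Sigma^*$ with $ab\sim_I ba$ for $(a,b)\in I$, and let $\mathbb{M}(\Sigma)=\Sigma^*/{\sim_I}$ be the trace monoid, with concatenation $\oplus$ and empty trace $\epsilon$. A tuple $(C,(O_j)_j,L,Q)$, with $L\subseteq \mathbb{M}(\Sigma)$ and $Q$ a set of query functions on $L$, specifies a Process-Commutative Object if: *Initial emptiness*: $\epsilon\in L$; *$C^*$-closure*: if $v\in L$ and $w$ is a trace all of whose letters are in $C$, then $v\oplus w\in L$; *$I$-diamond closure*: for all $i$, $v\in L$, $\mathsf{op}_i\in O_i$ and every trace $z$ with all letters in $\Sigma\setminus O_i$, if $v\oplus \mathsf{op}_i\in L$ and $v\oplus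 z\in L$ then $v\oplus z\oplus \mathsf{op}_i\in L$. **Multiple Idempotent Work Stealing Deque.** $\mathbb{T}=\bigcup_i\mathbb{T}_i$ is the set of tasks, where the pairwise disjoint sets $\mathbb{T}_i$ contain the tasks that $p_i$ may submit; $\mathbb{V}$ is a set of task results; for each task a subset of results is designated as valid. Updates: $C=\{\mathsf{addResult}_{t,r}\mid t\in\mathbb{T},\ r\in\mathbb{V}\text{ is a valid result for }t\}$ and $O_i=\{\mathsf{pushBottom}_{i,t},\mathsf{remove}_{i,t}\}_{t\in\mathbb{T}_i}\cup\{\mathsf{popBottom}_i\}$. For a sequence $s$ of tasks, $s\backslash t$ is $s$ with all occurrences of $t$ removed; $s[a..b]$ is the subsequence of elements $a$ to $b$ for $a\le b$, with $s[a..a-1]=\epsilon$ and $s[a..b]=\bot$ (a non-value) if $a>b+1$. The function $\mathsf{d\_state}:[1..n]\times\mathbb{M}(\Sigma)\to\mathbb{T}^*\cup\{\bot\}$ is defined recursively by $\mathsf{d\_state}(i,\epsilon)=\epsilon$; if $s=\mathsf{d\_state}(i,v)\ne\bot$ then $\mathsf{d\_state}(i,v\oplus\mathsf{pushBottom}_{i,t})=s\oplus t$, $\mathsf{d\_state}(i,v\oplus\mathsf{popBottom}_i)=s[2..|s|]$, $\mathsf{d\_state}(i,v\oplus\mathsf{remove}_{i,t})=s\backslash t$, and $\mathsf{d\_state}(i,v\oplus\mathsf{op})=s$ for every update $\mathsf{op}\notin O_i$; if $\mathsf{d\_state}(i,v)=\bot$ then $\mathsf{d\_state}(i,v\oplus\mathsf{op})=\bot$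 for every update $\mathsf{op}$. Queries: $Q=\{\mathsf{getTop}_i,\mathsf{getBottom}_i,\mathsf{getPending}_i\}_{i}\cup\{\mathsf{getResults}_t\}_{t\in\mathbb{T}}$, where, with $s=\mathsf{d\_state}(i,v)$ and $s[k]$ the $k$-th element of $s$ ($\bot$ if $k\notin[1..|s|]$): $\mathsf{getTop}_i(v)=s[|s|]$, $\mathsf{getBottom}_i(v)=s[1]$, $\mathsf{getPending}_i(v)$ is the set of tasks occurring in $s$, and $\mathsf{getResults}_t(v)=\{r\mid\mathsf{addResult}_{t,r}\text{ occurs in }v\}$. Moreover $\mathsf{popBottom}_i$ applied after $v$ outputs $s[1]$; other updates are silent. *)

theory Defs
  imports Main "HOL-Library.FuncSet" "HOL-Library.Disjoint_Sets"
begin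

section \<open>Trace monoids\<close>

text \<open>The least congruence on the free monoid \<open>lists S\<close> identifying \<open>[a, b]\<close> and \<open>[b, a]\<close> for
  \<open>(a, b) \<in> I\<close>; the independence relation is meant to satisfy \<open>I \<subseteq> S \<times> S\<close>.\<close>

inductive_set trace_cong :: "'a set \<Rightarrow> ('a \<times> 'a) set \<Rightarrow> ('a list \<times> 'a list) set"
  for S :: "'a set" and I :: "('a \<times> 'a) set" where
  refl: "w \<in> lists S \<Longrightarrow> (w, w) \<in> trace_cong S I"
| sym: "(u, v) \<in> trace_cong S I \<Longrightarrow> (v, u) \<in> trace_cong S I"
| trans: "(u, v) \<in> trace_cong S I \<Longrightarrow> (v, w) \<in> trace_cong S I \<Longrightarrow> (u, w) \<in> trace_cong S I"
| append: "(u, u') \<in> trace_cong S I \<Longrightarrow> (v, v') \<in> trace_cong S I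
    \<Longrightarrow> (u @ v, u' @ v') \<in> trace_cong S I"
| swap: "(a, b) \<in> I \<Longrightarrow> ([a, b], [b, a]) \<in> trace_cong S I"

type_synonym 'a trace = "'a list set"

definition traces :: "'a set \<Rightarrow> ('a \<times> 'a) set \<Rightarrow> 'a trace set" where
  "traces S I = lists S // trace_cong S I"

definition trace_of :: "'a set \<Rightarrow> ('a \<times> 'a) set \<Rightarrow> 'a list \<Rightarrow> 'a trace" where
  "trace_of S I w = trace_cong S I `` {w}"

definition trace_append :: "'a set \<Rightarrow> ('a \<times> 'a) set \<Rightarrow> 'a trace \<Rightarrow> 'a trace \<Rightarrow> 'a trace" where
  "trace_append S I u v = (\<Union>x\<in>u. \<Union>y\<in>v. trace_of S I (x @ y))"

definition trace_letters :: "'a trace \<Rightarrow> 'a set" where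
  "trace_letters v = (\<Union>w\<in>v. set w)"

text \<open>Functions on traces are obtained from functions on words that are constant on every
  equivalence class; \<^const>\<open>the_elem\<close> selects the common value.\<close>

definition trace_count :: "'a trace \<Rightarrow> 'a \<Rightarrow> nat" where
  "trace_count v x = the_elem ((\<lambda>w. count_list w x) ` v)"

lemma trace_cong_subset:
  assumes "I \<subseteq> S \<times> S"
  shows "trace_cong S I \<subseteq> lists S \<times> lists S"
proof -
  have "u \<in> lists S \<and> v \<in> lists S" if "(u, v) \<in> trace_cong S I" for u v
    using that by induction (use assms in auto)
  then show ?thesis by auto
qed

lemma equiv_trace_cong:
  assumes "I \<subseteq> S \<times> S"
  shows "equiv (lists S) (trace_cong S I)"
proof (rule equivI)
  show "trace_cong S I \<subseteq> lists S \<times> lists S" by (rule trace_cong_subset[OF assms])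
  show "refl_on (lists S) (trace_cong S I)"
    by (rule refl_onI) (rule trace_cong.refl)
  show "sym (trace_cong S I)" by (rule symI) (rule trace_cong.sym)
  show "trans (trace_cong S I)" by (rule transI) (rule trace_cong.trans)
qed

lemma trace_of_eq_iff:
  assumes "I \<subseteq> S \<times> S" "u \<in> lists S" "v \<in> lists S"
  shows "trace_of S I u = trace_of S I v \<longleftrightarrow> (u, v) \<in> trace_cong S I"
  unfolding trace_of_def using eq_equiv_class_iff[OF equiv_trace_cong[OF assms(1)] assms(2,3)] .

lemma traces_cases:
  assumes "v \<in> traces S I"
  obtains w where "w \<in> lists S" "v = trace_of S I w"
proof -
  from assms obtain w where "w \<in> lists S" "v = trace_cong S I `` {w}"
    unfolding traces_def by (rule quotientE)
  with that show thesis by (simp add: trace_of_def)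
qed

lemma trace_of_in_traces: "w \<in> lists S \<Longrightarrow> trace_of S I w \<in> traces S I"
  unfolding traces_def trace_of_def by (rule quotientI)

lemma trace_append_trace_of:
  assumes "I \<subseteq> S \<times> S" "u \<in> lists S" "v \<in> lists S"
  shows "trace_append S I (trace_of S I u) (trace_of S I v) = trace_of S I (u @ v)"
proof -
  have eq: "trace_of S I (x @ y) = trace_of S I (u @ v)"
    if "x \<in> trace_of S I u" "y \<in> trace_of S I v" for x y
  proof -
    have "(u @ v, x @ y) \<in> trace_cong S I"
      using that by (auto simp: trace_of_def intro: trace_cong.append)
    then show ?thesis
      unfolding trace_of_def by (rule equiv_class_eq[OF equiv_trace_cong[OF assms(1)], symmetric])
  qed
  have "u \<in> trace_of S I u" "v \<in> trace_of S I v"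
    using trace_cong.refl[OF assms(2)] trace_cong.refl[OF assms(3)] by (simp_all add: trace_of_def)
  then have ne: "trace_of S I u \<noteq> {}" "trace_of S I v \<noteq> {}" by blast+
  have "trace_append S I (trace_of S I u) (trace_of S I v) =
      (\<Union>x\<in>trace_of S I u. \<Union>y\<in>trace_of S I v. trace_of S I (u @ v))"
    unfolding trace_append_def by (intro SUP_cong HOL.refl) (rule eq)
  also have "\<dots> = trace_of S I (u @ v)"
    using ne by simp
  finally show ?thesis .
qed

lemma the_elem_trace_of:
  assumes "w \<in> lists S" "\<And>u v. (u, v) \<in> trace_cong S I \<Longrightarrow> f u = f v"
  shows "the_elem (f ` trace_of S I w) = f w"
proof -
  have "f ` trace_of S I w = {f w}"
  proof
    show "f ` trace_of S I w \<subseteq> {f w}"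
      using assms(2)[of w] by (auto simp: trace_of_def)
    show "{f w} \<subseteq> f ` trace_of S I w"
      using trace_cong.refl[OF assms(1), of I] by (simp add: trace_of_def)
  qed
  then show ?thesis by simp
qed

lemma trace_count_trace_of:
  assumes "w \<in> lists S"
  shows "trace_count (trace_of S I w) x = count_list w x"
proof -
  have "count_list u x = count_list v x" if "(u, v) \<in> trace_cong S I" for u v
    using that by induction simp_all
  from the_elem_trace_of[OF assms this] show ?thesis unfolding trace_count_def .
qed

lemma trace_letters_trace_of:
  assumes "w \<in> lists S"
  shows "trace_letters (trace_of S I w) = set w"
proof -
  have eq: "set u = set v" if "(u, v) \<in> trace_cong S I" for u v
    using that
  proof induction
    case (swap a b)
    then show ?case by (simp add: insert_commute)
  qed simp_all
  have "w \<in> trace_of S I w"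
    using trace_cong.refl[OF assms] by (simp add: trace_of_def)
  then have ne: "trace_of S I w \<noteq> {}" by blast
  have "trace_letters (trace_of S I w) = (\<Union>u\<in>trace_of S I w. set w)"
    unfolding trace_letters_def
    by (intro SUP_cong HOL.refl) (use eq[of w] in \<open>simp add: trace_of_def\<close>)
  then show ?thesis using ne by simp
qed


section \<open>Process-Commutative Objects\<close>

text \<open>Processes are numbered \<open>1, \<dots>, n\<close>; \<open>C\<close> is the set of common updates and \<open>X i\<close> the set of
  updates exclusive to process \<open>i\<close>.\<close>

definition alphabet :: "nat \<Rightarrow> 'a set \<Rightarrow> (nat \<Rightarrow> 'a set) \<Rightarrow> 'a set" where
  "alphabet n C X = C \<union> (\<Union>i\<in>{1..n}. X i)"

definition independence :: "nat \<Rightarrow> 'a set \<Rightarrow> (nat \<Rightarrow> 'a set) \<Rightarrow> ('a \<times> 'a) set" where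
  "independence n C X = alphabet n C X \<times> alphabet n C X - (\<Union>i\<in>{1..n}. X i \<times> X i)"

definition pco_traces :: "nat \<Rightarrow> 'a set \<Rightarrow> (nat \<Rightarrow> 'a set) \<Rightarrow> 'a trace set" where
  "pco_traces n C X = traces (alphabet n C X) (independence n C X)"

definition pco_trace_of :: "nat \<Rightarrow> 'a set \<Rightarrow> (nat \<Rightarrow> 'a set) \<Rightarrow> 'a list \<Rightarrow> 'a trace" where
  "pco_trace_of n C X = trace_of (alphabet n C X) (independence n C X)"

definition pco_append ::
  "nat \<Rightarrow> 'a set \<Rightarrow> (nat \<Rightarrow> 'a set) \<Rightarrow> 'a trace \<Rightarrow> 'a trace \<Rightarrow> 'a trace" where
  "pco_append n C X = trace_append (alphabet n C X) (independence n C X)"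

definition initial_emptiness ::
  "nat \<Rightarrow> 'a set \<Rightarrow> (nat \<Rightarrow> 'a set) \<Rightarrow> 'a trace set \<Rightarrow> bool" where
  "initial_emptiness n C X L \<longleftrightarrow> pco_trace_of n C X [] \<in> L"

definition common_closure ::
  "nat \<Rightarrow> 'a set \<Rightarrow> (nat \<Rightarrow> 'a set) \<Rightarrow> 'a trace set \<Rightarrow> bool" where
  "common_closure n C X L \<longleftrightarrow>
    (\<forall>v\<in>L. \<forall>w\<in>pco_traces n C X. trace_letters w \<subseteq> C \<longrightarrow> pco_append n C X v w \<in> L)"

definition diamond_closure ::
  "nat \<Rightarrow> 'a set \<Rightarrow> (nat \<Rightarrow> 'a set) \<Rightarrow> 'a trace set \<Rightarrow> bool" where
  "diamond_closure n C X L \<longleftrightarrow>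
    (\<forall>i\<in>{1..n}. \<forall>v\<in>L. \<forall>x\<in>X i. \<forall>z\<in>pco_traces n C X.
      trace_letters z \<subseteq> alphabet n C X - X i \<longrightarrow>
      pco_append n C X v (pco_trace_of n C X [x]) \<in> L \<longrightarrow>
      pco_append n C X v z \<in> L \<longrightarrow>
      pco_append n C X (pco_append n C X v z) (pco_trace_of n C X [x]) \<in> L)"

text \<open>A query function on \<open>L\<close> is a function with domain \<open>L\<close>, i.e. one that is
  \<^const>\<open>undefined\<close> outside \<open>L\<close>.\<close>

definition process_commutative_object ::
  "nat \<Rightarrow> 'a set \<Rightarrow> (nat \<Rightarrow> 'a set) \<Rightarrow> 'a trace set \<Rightarrow> ('a trace \<Rightarrow> 'q) set \<Rightarrow> bool" where
  "process_commutative_object n C X L Q \<longleftrightarrow>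
    (\<forall>i\<in>{1..n}. C \<inter> X i = {}) \<and> disjoint_family_on X {1..n} \<and>
    L \<subseteq> pco_traces n C X \<and> Q \<subseteq> (L \<rightarrow>\<^sub>E UNIV) \<and>
    initial_emptiness n C X L \<and> common_closure n C X L \<and> diamond_closure n C X L"

lemma independence_subset: "independence n C X \<subseteq> alphabet n C X \<times> alphabet n C X"
  unfolding independence_def by blast


section \<open>The Multiple Idempotent Work Stealing Deque\<close>

datatype ('t, 'r) update =
    AddResult 't 'r
  | PushBottom nat 't
  | PopBottom nat
  | Remove nat 't

datatype ('t, 'r) answer =
    Task "'t option"
  | Tasks "'t set"
  | Results "'r set"

definition all_tasks :: "nat \<Rightarrow> (nat \<Rightarrow> 't set) \<Rightarrow> 't set" where
  "all_tasks n T = (\<Union>i\<in>{1..n}. T i)"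

definition deque_common ::
  "nat \<Rightarrow> (nat \<Rightarrow> 't set) \<Rightarrow> 'r set \<Rightarrow> ('t \<Rightarrow> 'r set) \<Rightarrow> ('t, 'r) update set" where
  "deque_common n T V valid =
    {AddResult t r | t r. t \<in> all_tasks n T \<and> r \<in> V \<and> r \<in> valid t}"

definition deque_exclusive :: "(nat \<Rightarrow> 't set) \<Rightarrow> nat \<Rightarrow> ('t, 'r) update set" where
  "deque_exclusive T i =
    {PushBottom i t | t. t \<in> T i} \<union> {Remove i t | t. t \<in> T i} \<union> {PopBottom i}"

text \<open>Sequences are indexed from 1, as in \<open>s[k]\<close> and \<open>s[a..b]\<close> with \<open>a \<ge> 1\<close>; \<^const>\<open>None\<close> plays
  the role of the non-value \<open>\<bottom>\<close>.\<close>

definition elem_at :: "'t list \<Rightarrow> nat \<Rightarrow> 't option" where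
  "elem_at s k = (if k \<in> {1..length s} then Some (s ! (k - 1)) else None)"

definition subseq_at :: "'t list \<Rightarrow> nat \<Rightarrow> nat \<Rightarrow> 't list option" where
  "subseq_at s a b = (if a > b + 1 then None else Some (take (b + 1 - a) (drop (a - 1) s)))"

fun d_step :: "nat \<Rightarrow> 't list \<Rightarrow> ('t, 'r) update \<Rightarrow> 't list option" where
  "d_step i s (PushBottom j t) = (if j = i then Some (s @ [t]) else Some s)"
| "d_step i s (PopBottom j) = (if j = i then subseq_at s 2 (length s) else Some s)"
| "d_step i s (Remove j t) = (if j = i then Some (removeAll t s) else Some s)"
| "d_step i s (AddResult t r) = Some s"

definition d_word :: "nat \<Rightarrow> ('t, 'r) update list \<Rightarrow> 't list option" where
  "d_word i w = foldl (\<lambda>s x. Option.bind s (\<lambda>s. d_step i s x)) (Some []) w"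

text \<open>The recursive characterisation of \<open>d_state\<close> on traces is given by the lemmas
  \<open>d_state_empty\<close> and \<open>d_state_append_*\<close> below.\<close>

definition d_state :: "nat \<Rightarrow> ('t, 'r) update trace \<Rightarrow> 't list option" where
  "d_state i v = the_elem (d_word i ` v)"

definition deque_language ::
  "nat \<Rightarrow> (nat \<Rightarrow> 't set) \<Rightarrow> 'r set \<Rightarrow> ('t \<Rightarrow> 'r set) \<Rightarrow> ('t, 'r) update trace set" where
  "deque_language n T V valid =
    {v \<in> pco_traces n (deque_common n T V valid) (deque_exclusive T).
      \<forall>i\<in>{1..n}. \<forall>t\<in>all_tasks n T.
        trace_count v (PushBottom i t) \<le> 1 \<and> d_state i v \<noteq> None}"

definition getTop :: "nat \<Rightarrow> ('t, 'r) update trace \<Rightarrow> ('t, 'r) answer" where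
  "getTop i v = Task (Option.bind (d_state i v) (\<lambda>s. elem_at s (length s)))"

definition getBottom :: "nat \<Rightarrow> ('t, 'r) update trace \<Rightarrow> ('t, 'r) answer" where
  "getBottom i v = Task (Option.bind (d_state i v) (\<lambda>s. elem_at s 1))"

definition getPending :: "nat \<Rightarrow> ('t, 'r) update trace \<Rightarrow> ('t, 'r) answer" where
  "getPending i v = Tasks {t. \<exists>s. d_state i v = Some s \<and> t \<in> set s}"

definition getResults :: "'t \<Rightarrow> ('t, 'r) update trace \<Rightarrow> ('t, 'r) answer" where
  "getResults t v = Results {r. AddResult t r \<in> trace_letters v}"

definition deque_queries ::
  "nat \<Rightarrow> (nat \<Rightarrow> 't set) \<Rightarrow> 'r set \<Rightarrow> ('t \<Rightarrow> 'r set)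
    \<Rightarrow> (('t, 'r) update trace \<Rightarrow> ('t, 'r) answer) set" where
  "deque_queries n T V valid =
    (\<Union>i\<in>{1..n}. {restrict (getTop i) (deque_language n T V valid),
                  restrict (getBottom i) (deque_language n T V valid),
                  restrict (getPending i) (deque_language n T V valid)}) \<union>
    {restrict (getResults t) (deque_language n T V valid) | t. t \<in> all_tasks n T}"

lemma d_word_snoc: "d_word i (w @ [x]) = Option.bind (d_word i w) (\<lambda>s. d_step i s x)"
  unfolding d_word_def by simp

context
  fixes n :: nat and T :: "nat \<Rightarrow> 't set" and V :: "'r set" and valid :: "'t \<Rightarrow> 'r set"
    and C :: "('t, 'r) update set" and X :: "nat \<Rightarrow> ('t, 'r) update set"
  defines "C \<equiv> deque_common n T V valid" and "X \<equiv> deque_exclusive T"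
begin

lemma d_step_other:
  assumes "i \<in> {1..n}" "x \<in> alphabet n C X" "x \<notin> X i"
  shows "d_step i s x = Some s"
  using assms by (cases x) (auto simp: alphabet_def C_def X_def deque_common_def deque_exclusive_def)

lemma d_word_cong:
  assumes i: "i \<in> {1..n}"
    and "(u, v) \<in> trace_cong (alphabet n C X) (independence n C X)"
  shows "d_word i u = d_word i v"
proof -
  define g :: "'t list option \<Rightarrow> ('t, 'r) update list \<Rightarrow> 't list option"
    where "g = foldl (\<lambda>s x. Option.bind s (\<lambda>s. d_step i s x))"
  have "g s u = g s v" for s
    using assms(2)
  proof (induction arbitrary: s)
    case (swap a b)
    then have "a \<notin> X i \<or> b \<notin> X i" "a \<in> alphabet n C X" "b \<in> alphabet n C X"
      using i by (auto simp: independence_def)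
    with d_step_other[OF i, of a] d_step_other[OF i, of b]
    have "(\<forall>s. d_step i s a = Some s) \<or> (\<forall>s. d_step i s b = Some s)"
      by blast
    then show ?case by (cases s) (auto simp: g_def)
  next
    case (append u u' v v')
    then show ?case by (simp add: g_def)
  qed simp_all
  then show ?thesis by (simp add: d_word_def g_def)
qed

lemma d_state_trace_of:
  assumes "i \<in> {1..n}" "w \<in> lists (alphabet n C X)"
  shows "d_state i (pco_trace_of n C X w) = d_word i w"
  unfolding d_state_def pco_trace_of_def
  using the_elem_trace_of[OF assms(2) d_word_cong[OF assms(1)]] .

lemma d_state_empty:
  assumes "i \<in> {1..n}"
  shows "d_state i (pco_trace_of n C X []) = Some []"
  using d_state_trace_of[OF assms, of "[]"] by (simp add: d_word_def)

lemma d_state_append: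
  assumes i: "i \<in> {1..n}" and v: "v \<in> pco_traces n C X" and x: "x \<in> alphabet n C X"
  shows "d_state i (pco_append n C X v (pco_trace_of n C X [x])) =
    Option.bind (d_state i v) (\<lambda>s. d_step i s x)"
proof -
  from v obtain w where w: "w \<in> lists (alphabet n C X)" "v = pco_trace_of n C X w"
    unfolding pco_traces_def pco_trace_of_def by (rule traces_cases)
  have "pco_append n C X v (pco_trace_of n C X [x]) = pco_trace_of n C X (w @ [x])"
    unfolding w(2) pco_append_def pco_trace_of_def
    by (rule trace_append_trace_of[OF independence_subset]) (use w x in auto)
  with w x show ?thesis by (simp add: d_state_trace_of[OF i] d_word_snoc)
qed

lemma
  assumes i: "i \<in> {1..n}" and v: "v \<in> pco_traces n C X"
  shows d_state_append_undefined: "x \<in> alphabet n C X \<Longrightarrow> d_state i v = None \<Longrightarrow>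
      d_state i (pco_append n C X v (pco_trace_of n C X [x])) = None"
    and d_state_append_push: "t \<in> T i \<Longrightarrow> d_state i v = Some s \<Longrightarrow>
      d_state i (pco_append n C X v (pco_trace_of n C X [PushBottom i t])) = Some (s @ [t])"
    and d_state_append_pop: "d_state i v = Some s \<Longrightarrow>
      d_state i (pco_append n C X v (pco_trace_of n C X [PopBottom i])) = subseq_at s 2 (length s)"
    and d_state_append_remove: "t \<in> T i \<Longrightarrow> d_state i v = Some s \<Longrightarrow>
      d_state i (pco_append n C X v (pco_trace_of n C X [Remove i t])) = Some (removeAll t s)"
    and d_state_append_other: "x \<in> alphabet n C X - X i \<Longrightarrow> d_state i v = Some s \<Longrightarrow>
      d_state i (pco_append n C X v (pco_trace_of n C X [x])) = Some s"
proof -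
  have X: "X i \<subseteq> alphabet n C X" using i by (auto simp: alphabet_def)
  have mem: "PopBottom i \<in> alphabet n C X"
    "t \<in> T i \<Longrightarrow> PushBottom i t \<in> alphabet n C X" "t \<in> T i \<Longrightarrow> Remove i t \<in> alphabet n C X" for t
    by (rule subsetD[OF X]; simp add: X_def deque_exclusive_def)+
  note app = d_state_append[OF i v]
  show "x \<in> alphabet n C X \<Longrightarrow> d_state i v = None \<Longrightarrow>
      d_state i (pco_append n C X v (pco_trace_of n C X [x])) = None"
    by (simp add: app)
  show "t \<in> T i \<Longrightarrow> d_state i v = Some s \<Longrightarrow>
      d_state i (pco_append n C X v (pco_trace_of n C X [PushBottom i t])) = Some (s @ [t])"
    by (simp add: app mem)
  show "d_state i v = Some s \<Longrightarrow>
      d_state i (pco_append n C X v (pco_trace_of n C X [PopBottom i])) = subseq_at s 2 (length s)"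
    by (simp add: app mem)
  show "t \<in> T i \<Longrightarrow> d_state i v = Some s \<Longrightarrow>
      d_state i (pco_append n C X v (pco_trace_of n C X [Remove i t])) = Some (removeAll t s)"
    by (simp add: app mem)
  show "x \<in> alphabet n C X - X i \<Longrightarrow> d_state i v = Some s \<Longrightarrow>
      d_state i (pco_append n C X v (pco_trace_of n C X [x])) = Some s"
    by (simp add: app d_step_other[OF i])
qed

end

end

theory Submission
  imports Defs
begin

text \<open>Updates outside \<open>X i\<close> change neither the deque of process \<open>i\<close> nor the number of its pushes.
  Hence appending common updates preserves both conditions defining the language. Likewise, in the
  diamond, \<open>v \<oplus> z\<close> looks to process \<open>i\<close> like \<open>v\<close>, so that \<open>v \<oplus> z \<oplus> x\<close> looks to it like \<open>v \<oplus> x\<close>,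
  while to every other process it looks like \<open>v \<oplus> z\<close>.\<close>

text \<open>Each letter of \<open>z\<close> acts as the identity on the deque of \<open>i\<close>.
  The bound by the alphabet matters: \<open>PushBottom i t\<close> with \<open>t\<close> outside
  \<open>T i\<close> is not in \<open>deque_exclusive T i\<close>, yet changes that deque. As
  \<open>d_word\<close> is a left fold, letters are peeled off at the right end.\<close>

lemma d_word_append_other:
  fixes valid :: "'t \<Rightarrow> 'r set"
  assumes i: "i \<in> {1..n}"
    and "set z \<subseteq> alphabet n (deque_common n T V valid) (deque_exclusive T) - deque_exclusive T i"
  shows "d_word i (u @ z) = d_word i u"
  using assms(2)
proof (induction z rule: rev_induct)
  case (snoc x z)
  then have "d_step i s x = Some s" for s
    by (intro d_step_other[OF i]) auto
  with snoc show ?case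
    by (simp add: d_word_snoc flip: append_assoc)
qed simp

lemma pco_append_trace_of:
  assumes "u \<in> lists (alphabet n C X)" "v \<in> lists (alphabet n C X)"
  shows "pco_append n C X (pco_trace_of n C X u) (pco_trace_of n C X v) = pco_trace_of n C X (u @ v)"
  unfolding pco_append_def pco_trace_of_def
  by (rule trace_append_trace_of[OF independence_subset assms])

lemma pco_traces_cases:
  assumes "v \<in> pco_traces n C X"
  obtains w where "w \<in> lists (alphabet n C X)" "v = pco_trace_of n C X w"
  using assms unfolding pco_traces_def pco_trace_of_def by (rule traces_cases)

text \<open>Push counts and deque states are constant on congruence classes, so any representative
  decides membership. This turns the closure properties into statements about words.\<close>

lemma trace_of_in_deque_language_iff:
  fixes n :: nat and T :: "nat \<Rightarrow> 't set" and V :: "'r set" and valid :: "'t \<Rightarrow> 'r set"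
  defines "C \<equiv> deque_common n T V valid" and "X \<equiv> deque_exclusive T"
  assumes w: "w \<in> lists (alphabet n C X)"
  shows "pco_trace_of n C X w \<in> deque_language n T V valid \<longleftrightarrow>
    (\<forall>i\<in>{1..n}. \<forall>t\<in>all_tasks n T. count_list w (PushBottom i t) \<le> 1 \<and> d_word i w \<noteq> None)"
proof -
  have "pco_trace_of n C X w \<in> pco_traces n C X"
    unfolding pco_trace_of_def pco_traces_def by (rule trace_of_in_traces[OF w])
  moreover have "trace_count (pco_trace_of n C X w) x = count_list w x" for x
    unfolding pco_trace_of_def by (rule trace_count_trace_of[OF w])
  moreover have "d_state i (pco_trace_of n C X w) = d_word i w" if "i \<in> {1..n}" for i
    using d_state_trace_of[OF that] w unfolding C_def X_def by blast
  ultimately show ?thesis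
    unfolding deque_language_def C_def X_def by simp
qed

lemma deque_common_exclusive_disjoint: "deque_common n T V valid \<inter> deque_exclusive T i = {}"
  by (auto simp: deque_common_def deque_exclusive_def)

text \<open>Every exclusive update carries the index of its process.\<close>

lemma deque_exclusive_disjoint: "i \<noteq> j \<Longrightarrow> deque_exclusive T i \<inter> deque_exclusive T j = {}"
  by (auto simp: deque_exclusive_def)

lemma deque_initial_emptiness:
  "initial_emptiness n (deque_common n T V valid) (deque_exclusive T) (deque_language n T V valid)"
  unfolding initial_emptiness_def
  by (subst trace_of_in_deque_language_iff) (simp_all add: d_word_def)

lemma deque_common_closure:
  "common_closure n (deque_common n T V valid) (deque_exclusive T) (deque_language n T V valid)"
    (is "common_closure n ?C ?X ?L")
  unfolding common_closure_def
proof (intro ballI impI)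
  fix v w
  assume v: "v \<in> ?L" and w: "w \<in> pco_traces n ?C ?X" and wC: "trace_letters w \<subseteq> ?C"
  from v have "v \<in> pco_traces n ?C ?X"
    by (simp add: deque_language_def)
  then obtain v' where v': "v' \<in> lists (alphabet n ?C ?X)" "v = pco_trace_of n ?C ?X v'"
    by (rule pco_traces_cases)
  from w obtain w' where w': "w' \<in> lists (alphabet n ?C ?X)" "w = pco_trace_of n ?C ?X w'"
    by (rule pco_traces_cases)
  have wC': "set w' \<subseteq> ?C"
    using wC trace_letters_trace_of[OF w'(1)] by (simp add: w'(2) pco_trace_of_def)
  have other: "set w' \<subseteq> alphabet n ?C ?X - ?X i" for i
    using wC' w'(1) deque_common_exclusive_disjoint[of n T V valid i] by auto
  \<comment> \<open>Common updates are all of the form \<open>AddResult t r\<close>, so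
    \<open>w'\<close> contains no push.\<close>
  have "count_list w' (PushBottom i t) = 0" for i t
    using wC' by (auto simp: count_list_0_iff deque_common_def)
  then have "pco_trace_of n ?C ?X (v' @ w') \<in> ?L"
    using v v' w'(1) by (simp add: trace_of_in_deque_language_iff d_word_append_other[OF _ other])
  then show "pco_append n ?C ?X v w \<in> ?L"
    using v' w' by (simp add: pco_append_trace_of)
qed

lemma deque_diamond_closure:
  "diamond_closure n (deque_common n T V valid) (deque_exclusive T) (deque_language n T V valid)"
    (is "diamond_closure n ?C ?X ?L")
  unfolding diamond_closure_def
proof (intro ballI impI)
  let ?A = "alphabet n ?C ?X"
  fix i v x z
  assume i: "i \<in> {1..n}" and v: "v \<in> ?L" and x: "x \<in> ?X i" and z: "z \<in> pco_traces n ?C ?X"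
    and zX: "trace_letters z \<subseteq> ?A - ?X i"
    and vx: "pco_append n ?C ?X v (pco_trace_of n ?C ?X [x]) \<in> ?L"
    and vz: "pco_append n ?C ?X v z \<in> ?L"
  from v have "v \<in> pco_traces n ?C ?X"
    by (simp add: deque_language_def)
  then obtain v' where v': "v' \<in> lists ?A" "v = pco_trace_of n ?C ?X v'"
    by (rule pco_traces_cases)
  from z obtain z' where z': "z' \<in> lists ?A" "z = pco_trace_of n ?C ?X z'"
    by (rule pco_traces_cases)
  have zX': "set z' \<subseteq> ?A - ?X i"
    using zX trace_letters_trace_of[OF z'(1)] by (simp add: z'(2) pco_trace_of_def)
  have xA: "x \<in> ?A"
    using x i by (auto simp: alphabet_def)
  then have words: "[x] \<in> lists ?A" "v' @ [x] \<in> lists ?A" "v' @ z' \<in> lists ?A"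
      "(v' @ z') @ [x] \<in> lists ?A"
    using v'(1) z'(1) by auto
  from vx have vx': "pco_trace_of n ?C ?X (v' @ [x]) \<in> ?L"
    using v' words by (simp add: pco_append_trace_of del: append_in_lists_conv)
  from vz have vz': "pco_trace_of n ?C ?X (v' @ z') \<in> ?L"
    using v' z' by (simp add: pco_append_trace_of)
  \<comment> \<open>\<open>j\<close> and \<open>t\<close> are fixed together because definedness
    also sits under the quantifier over tasks: \<open>vx'\<close> and \<open>vz'\<close> yield it
    only for a given task.\<close>
  have "count_list ((v' @ z') @ [x]) (PushBottom j t) \<le> 1 \<and> d_word j ((v' @ z') @ [x]) \<noteq> None"
    if j: "j \<in> {1..n}" and t: "t \<in> all_tasks n T" for j t
  proof -
    from vx' j t have 1: "count_list (v' @ [x]) (PushBottom j t) \<le> 1" "d_word j (v' @ [x]) \<noteq> None"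
      unfolding trace_of_in_deque_language_iff[OF words(2)] by blast+
    from vz' j t have 2: "count_list (v' @ z') (PushBottom j t) \<le> 1" "d_word j (v' @ z') \<noteq> None"
      unfolding trace_of_in_deque_language_iff[OF words(3)] by blast+
    have "count_list ((v' @ z') @ [x]) (PushBottom j t) \<le> 1"
    proof (cases "x = PushBottom j t")
      case True
      \<comment> \<open>The letter lies in \<open>?X i\<close>, which \<open>z'\<close> avoids, so
        all its occurrences are already counted in \<open>v' @ [x]\<close>.\<close>
      with x zX' have "count_list z' (PushBottom j t) = 0"
        by (auto simp: count_list_0_iff)
      with 1(1) show ?thesis by simp
    next
      case False
      with 2(1) show ?thesis by simp
    qed
    \<comment> \<open>The critical letter is \<open>PopBottom j\<close>:
      \<open>subseq_at s 2 (length s)\<close> is \<open>None\<close> exactly for empty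
      \<open>s\<close>.\<close>
    moreover have "d_word j ((v' @ z') @ [x]) \<noteq> None"
    proof (cases "j = i")
      case True
      then have "d_word j (v' @ z') = d_word j v'"
        using d_word_append_other[OF i zX'] by simp
      \<comment> \<open>The bracketing keeps \<open>x\<close> as last letter; its effect depends on
        the preceding word only through the state reached.\<close>
      then have "d_word j ((v' @ z') @ [x]) = d_word j (v' @ [x])"
        by (simp only: d_word_snoc)
      with 1(2) show ?thesis by simp
    next
      case False
      \<comment> \<open>Now \<open>[x]\<close> itself is the foreign suffix: being exclusive to
        \<open>i\<close>, it avoids \<open>?X j\<close>.\<close>
      with x xA have "set [x] \<subseteq> ?A - ?X j"
        using deque_exclusive_disjoint[of i j T] by auto
      from d_word_append_other[OF j this] 2(2) show ?thesis by (simp del: append_assoc)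
    qed
    ultimately show ?thesis ..
  qed
  then have "pco_trace_of n ?C ?X ((v' @ z') @ [x]) \<in> ?L"
    unfolding trace_of_in_deque_language_iff[OF words(4)] by blast
  then show "pco_append n ?C ?X (pco_append n ?C ?X v z) (pco_trace_of n ?C ?X [x]) \<in> ?L"
    using v' z' words by (simp add: pco_append_trace_of)
qed

theorem theorem6:
  fixes n :: nat
    and T :: "nat \<Rightarrow> 't set"
    and V :: "'r set"
    and valid :: "'t \<Rightarrow> 'r set"
  assumes "disjoint_family_on T {1..n}"
    and "\<And>t. t \<in> all_tasks n T \<Longrightarrow> valid t \<subseteq> V"
  shows "process_commutative_object n
    (deque_common n T V valid) (deque_exclusive T)
    (deque_language n T V valid) (deque_queries n T V valid)"
  unfolding process_commutative_object_def
proof (intro conjI ballI)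
  show "disjoint_family_on (deque_exclusive T) {1..n}"
    by (simp add: disjoint_family_on_def deque_exclusive_disjoint)
  show "deque_language n T V valid
      \<subseteq> pco_traces n (deque_common n T V valid) (deque_exclusive T)"
    by (auto simp: deque_language_def)
  \<comment> \<open>Each query is a \<open>restrict\<close>, hence \<open>undefined\<close> outside
    the language.\<close>
  show "deque_queries n T V valid \<subseteq> deque_language n T V valid \<rightarrow>\<^sub>E UNIV"
    by (auto simp: deque_queries_def)
qed (rule deque_common_exclusive_disjoint deque_initial_emptiness deque_common_closure
    deque_diamond_closure)+

end
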